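(* Let $(\mathscr{G},\circ)$ be a dynamical group over a non-empty set $\Lambda$, with $\mathscr{G}=(G,\Lambda,\phi_G)$. Then $Q(\mathscr{G})=\Lambda\times G$ is a groupoid over $\Lambda$ with source map $\alpha(\lambda,a)=\lambda$, target map $\beta(\lambda,a)=\phi_G(\lambda,a)$, multiplication $$(\lambda,a)\star(\mu,b)=(\lambda,a\circ_\lambda b)\quad\text{whenever }\mu=\phi_G(\lambda,a),$$ unit map $\iota(\lambda)=(\lambda,e_G)$, and inverse map $\mathrm{inv}(\lambda,a)=(\phi_G(\lambda,a),\bar a^\lambda)$.
   Context: A dynamical set over $\Lambda$ is a triple $(X,\Lambda,\phi_X)$ with $X$ a set and $\phi_X:\Lambda\times X\to\Lambda$ a map. Dynamical group: a dynamical set $\mathscr{G}=(G,\Lambda,\phi_G)$ with maps $\circ_\lambda:G\times G\to G$ ($\lambda\in\Lambda$) such that $\phi_G(\lambda,a\circ_\lambda b)=\phi_G(\phi_G(\lambda,a),b)$ and $a\circ_\lambda(b\circ_{\phi_G(\lambda,a)}c)=(a\circ_\lambda b)\circ_\lambda c$; an element $e_G\in G$ with $a\circ_\lambda e_G=e_G\circ_\lambda a=a$ and $\phi_G(\lambda,e_G)=\lambda$; and for all $\lambda,a$ an element $\bar a^\lambda\in G$ (necessarily unique) with $a\circ_\lambda\bar a^\lambda=\bar a^\lambda\circ_{\phi_G(\lambda,a)}a=e_G$. Groupoid convention: $\gamma_1\star\gamma_2$ is defined when $\beta(\gamma_1)=\alpha(\gamma_2)$, with $\alpha(\gamma_1\star\gamma_2)=\alpha(\gamma_1)$,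 $\beta(\gamma_1\star\gamma_2)=\beta(\gamma_2)$; $\star$ is associative, $\iota_{\alpha(\gamma)}\star\gamma=\gamma=\gamma\star\iota_{\beta(\gamma)}$, $\gamma\star\mathrm{inv}(\gamma)=\iota_{\alpha(\gamma)}$, $\mathrm{inv}(\gamma)\star\gamma=\iota_{\beta(\gamma)}$; source and target maps are surjective. *)

theory Defs
  imports Main
begin

text \<open>
  The structure map \<open>\<phi> : \<Lambda> \<times> X \<rightarrow> \<Lambda>\<close> is curried; its values outside the carriers are irrelevant.
\<close>

locale dynamical_set =
  fixes X :: "'a set" and \<Lambda> :: "'l set" and \<phi> :: "'l \<Rightarrow> 'a \<Rightarrow> 'l"
  assumes phi_closed: "\<lbrakk>l \<in> \<Lambda>; x \<in> X\<rbrakk> \<Longrightarrow> \<phi> l x \<in> \<Lambda>"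

text \<open>\<open>cmp l a b\<close> stands for \<open>a \<circ>\<^sub>l b\<close>.\<close>

locale dynamical_group = dynamical_set G \<Lambda> \<phi>
  for G :: "'a set" and \<Lambda> :: "'l set" and \<phi> :: "'l \<Rightarrow> 'a \<Rightarrow> 'l" +
  fixes cmp :: "'l \<Rightarrow> 'a \<Rightarrow> 'a \<Rightarrow> 'a" and e :: 'a
  assumes cmp_closed: "\<lbrakk>l \<in> \<Lambda>; a \<in> G; b \<in> G\<rbrakk> \<Longrightarrow> cmp l a b \<in> G"
    and phi_cmp: "\<lbrakk>l \<in> \<Lambda>; a \<in> G; b \<in> G\<rbrakk> \<Longrightarrow> \<phi> l (cmp l a b) = \<phi> (\<phi> l a) b"
    and cmp_assoc: "\<lbrakk>l \<in> \<Lambda>; a \<in> G; b \<in> G; c \<in> G\<rbrakk> \<Longrightarrow>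
          cmp l a (cmp (\<phi> l a) b c) = cmp l (cmp l a b) c"
    and unit_closed: "e \<in> G"
    and cmp_unit_right: "\<lbrakk>l \<in> \<Lambda>; a \<in> G\<rbrakk> \<Longrightarrow> cmp l a e = a"
    and cmp_unit_left: "\<lbrakk>l \<in> \<Lambda>; a \<in> G\<rbrakk> \<Longrightarrow> cmp l e a = a"
    and phi_unit: "l \<in> \<Lambda> \<Longrightarrow> \<phi> l e = l"
    and inverse_exists: "\<lbrakk>l \<in> \<Lambda>; a \<in> G\<rbrakk> \<Longrightarrow>
          \<exists>b\<in>G. cmp l a b = e \<and> cmp (\<phi> l a) b a = e"

definition dyn_inverse ::
  "'a set \<Rightarrow> ('l \<Rightarrow> 'a \<Rightarrow> 'l) \<Rightarrow> ('l \<Rightarrow> 'a \<Rightarrow> 'a \<Rightarrow> 'a) \<Rightarrow> 'a \<Rightarrow> 'l \<Rightarrow> 'a \<Rightarrow> 'a" where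
  "dyn_inverse G \<phi> cmp e l a = (THE b. b \<in> G \<and> cmp l a b = e \<and> cmp (\<phi> l a) b a = e)"

text \<open>The description in \<open>dyn_inverse\<close> is proper for \<open>l \<in> \<Lambda>\<close> and \<open>a \<in> G\<close>:\<close>

lemma (in dynamical_group) inverse_ex1:
  assumes l: "l \<in> \<Lambda>" and a: "a \<in> G"
  shows "\<exists>!b. b \<in> G \<and> cmp l a b = e \<and> cmp (\<phi> l a) b a = e"
proof -
  have "b = c" if b: "b \<in> G" "cmp l a b = e" "cmp (\<phi> l a) b a = e"
    and c: "c \<in> G" "cmp l a c = e" for b c
  proof -
    have m: "\<phi> l a \<in> \<Lambda>" using l a by (rule phi_closed)
    have ret: "\<phi> (\<phi> l a) b = l" using phi_cmp[OF l a b(1)] phi_unit[OF l] b(2) by simp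
    have "b = cmp (\<phi> l a) b (cmp l a c)" using cmp_unit_right[OF m b(1)] c(2) by simp
    also have "\<dots> = cmp (\<phi> l a) (cmp (\<phi> l a) b a) c"
      using cmp_assoc[OF m b(1) a c(1)] ret by simp
    also have "\<dots> = c" using cmp_unit_left[OF m c(1)] b(3) by simp
    finally show ?thesis .
  qed
  then show ?thesis using inverse_exists[OF l a] by blast
qed

text \<open>
  Groupoids over \<open>\<Lambda>\<close> with set of arrows \<open>Q\<close>. Arrows compose in diagrammatic order. The partial
  multiplication is encoded by a total function, which is only meaningful on the composable pairs,
  i.e. those with \<open>\<beta> g = \<alpha> h\<close>.
\<close>

locale groupoid_over =
  fixes \<Lambda> :: "'l set" and Q :: "'q set"
    and \<alpha> :: "'q \<Rightarrow> 'l" and \<beta> :: "'q \<Rightarrow> 'l"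
    and mult :: "'q \<Rightarrow> 'q \<Rightarrow> 'q" and \<iota> :: "'l \<Rightarrow> 'q" and inv :: "'q \<Rightarrow> 'q"
  assumes source_surj: "\<alpha> ` Q = \<Lambda>"
    and target_surj: "\<beta> ` Q = \<Lambda>"
    and mult_closed: "\<lbrakk>g \<in> Q; h \<in> Q; \<beta> g = \<alpha> h\<rbrakk> \<Longrightarrow> mult g h \<in> Q"
    and source_mult: "\<lbrakk>g \<in> Q; h \<in> Q; \<beta> g = \<alpha> h\<rbrakk> \<Longrightarrow> \<alpha> (mult g h) = \<alpha> g"
    and target_mult: "\<lbrakk>g \<in> Q; h \<in> Q; \<beta> g = \<alpha> h\<rbrakk> \<Longrightarrow> \<beta> (mult g h) = \<beta> h"
    and mult_assoc: "\<lbrakk>g \<in> Q; h \<in> Q; k \<in> Q; \<beta> g = \<alpha> h; \<beta> h = \<alpha> k\<rbrakk> \<Longrightarrow>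
          mult (mult g h) k = mult g (mult h k)"
    and unit_closed: "l \<in> \<Lambda> \<Longrightarrow> \<iota> l \<in> Q"
    and source_unit: "l \<in> \<Lambda> \<Longrightarrow> \<alpha> (\<iota> l) = l"
    and target_unit: "l \<in> \<Lambda> \<Longrightarrow> \<beta> (\<iota> l) = l"
    and unit_mult: "g \<in> Q \<Longrightarrow> mult (\<iota> (\<alpha> g)) g = g"
    and mult_unit: "g \<in> Q \<Longrightarrow> mult g (\<iota> (\<beta> g)) = g"
    and inv_closed: "g \<in> Q \<Longrightarrow> inv g \<in> Q"
    and source_inv: "g \<in> Q \<Longrightarrow> \<alpha> (inv g) = \<beta> g"
    and target_inv: "g \<in> Q \<Longrightarrow> \<beta> (inv g) = \<alpha> g"
    and mult_inv: "g \<in> Q \<Longrightarrow> mult g (inv g) = \<iota> (\<alpha> g)"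
    and inv_mult: "g \<in> Q \<Longrightarrow> mult (inv g) g = \<iota> (\<beta> g)"

end

theory Submission
  imports Defs
begin

text \<open>This is the analogue of an action groupoid: \<open>(l, a)\<close> is an arrow from
  \<open>l\<close> to \<open>\<phi> l a\<close>, and composability puts the second factor at the
  base point \<open>\<phi> l a\<close>, exactly as the twisted associativity law
  \<open>cmp_assoc\<close> demands. Each groupoid axiom is then a dynamical group axiom read at the
  source; only the endpoints of inverse arrows need an extra computation,
  \<open>phi_dyn_inverse\<close>.\<close>

lemma (in dynamical_group) dyn_inverse:
  assumes "l \<in> \<Lambda>" and "a \<in> G"
  shows dyn_inverse_closed: "dyn_inverse G \<phi> cmp e l a \<in> G"
    and cmp_dyn_inverse: "cmp l a (dyn_inverse G \<phi> cmp e l a) = e"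
    and dyn_inverse_cmp: "cmp (\<phi> l a) (dyn_inverse G \<phi> cmp e l a) a = e"
  using theI'[OF inverse_ex1[OF assms]] unfolding dyn_inverse_def by blast+

text \<open>Moving by \<open>a\<close> and then by its inverse is moving by their product
  \<open>e\<close>, which fixes \<open>l\<close>. Hence the inverse arrow ends where the original
  one starts.\<close>

lemma (in dynamical_group) phi_dyn_inverse:
  assumes "l \<in> \<Lambda>" and "a \<in> G"
  shows "\<phi> (\<phi> l a) (dyn_inverse G \<phi> cmp e l a) = l"
  using phi_cmp[OF assms dyn_inverse_closed[OF assms]]
  by (simp add: assms cmp_dyn_inverse phi_unit)

theorem proposition2p27:
  fixes G :: "'a set" and \<Lambda> :: "'l set" and \<phi> :: "'l \<Rightarrow> 'a \<Rightarrow> 'l"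
    and cmp :: "'l \<Rightarrow> 'a \<Rightarrow> 'a \<Rightarrow> 'a" and e :: 'a
  assumes "\<Lambda> \<noteq> {}"
    and "dynamical_group G \<Lambda> \<phi> cmp e"
  shows "groupoid_over \<Lambda> (\<Lambda> \<times> G)
           (\<lambda>(l, a). l)
           (\<lambda>(l, a). \<phi> l a)
           (\<lambda>(l, a) (m, b). (l, cmp l a b))
           (\<lambda>l. (l, e))
           (\<lambda>(l, a). (\<phi> l a, dyn_inverse G \<phi> cmp e l a))"
proof -
  interpret dynamical_group G \<Lambda> \<phi> cmp e by fact
  \<comment> \<open>The loop \<open>(l, e)\<close> is a preimage of \<open>l\<close> under both
    source and target.\<close>
  have "(\<lambda>(l, a). l) ` (\<Lambda> \<times> G) = \<Lambda>"
    using unit_closed by force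
  moreover have "(\<lambda>(l, a). \<phi> l a) ` (\<Lambda> \<times> G) = \<Lambda>"
    using unit_closed phi_unit phi_closed by force
  ultimately show ?thesis
    by unfold_locales
      (auto simp: phi_closed cmp_closed phi_cmp cmp_assoc unit_closed cmp_unit_right cmp_unit_left
        phi_unit dyn_inverse phi_dyn_inverse)
qed

end
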